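(* Let $\pi\colon(X,T)\to(Y,S)$ be a factor map between dynamical systems and $n\geq 2$. If $(X,T)$ is $n$-tuplewise thickly sensitive and $\pi$ is proximal, then $(Y,S)$ is also $n$-tuplewise thickly sensitive.
   Context: A dynamical system is a pair $(X,T)$ where $X$ is a compact metric space with metric $d$ and $T\colon X\to X$ is a continuous surjection. $\mathbb{N}$ is the set of positive integers. A factor map $\pi\colon(X,T)\to(Y,S)$ is a continuous surjection with $\pi\circ T=S\circ\pi$. A pair $(x,y)\in X^2$ is proximal if $\liminf_{k\to\infty}d(T^kx,T^ky)=0$. The factor map $\pi$ is proximal if every pair $(x,y)\in X^2$ with $\pi(x)=\pi(y)$ is proximal. A set $F\subset\mathbb{N}$ is thick if for every $L\in\mathbb{N}$ there is $m\in\mathbb{N}$ with $\{m,m+1,\dots,m+L\}\subset F$. $(X,T)$ is $n$-tuplewise thickly sensitive if there is a constant $\delta>0$ such that for every non-empty open $U\subset X$ there exist $x_1,\dots,x_n\in U$ such that $\{k\in\mathbb{N}: \min_{1\le i<j\le n}d(T^kx_i,T^kx_j)>\delta\}$ is thick. *)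

theory Defs
  imports "HOL-Analysis.Analysis"
begin

text \<open>
  The phase space is a compact subset of a metric space type, with the restricted metric; the
  values of the maps outside their phase spaces are irrelevant. Positive integers are
  natural numbers \<open>k \<ge> 1\<close>.
\<close>

definition dynamical_system :: "'a::metric_space set \<Rightarrow> ('a \<Rightarrow> 'a) \<Rightarrow> bool" where
  "dynamical_system X T \<longleftrightarrow> compact X \<and> continuous_on X T \<and> T ` X = X"

definition factor_map ::
  "'a::metric_space set \<Rightarrow> ('a \<Rightarrow> 'a) \<Rightarrow> 'b::metric_space set \<Rightarrow> ('b \<Rightarrow> 'b) \<Rightarrow> ('a \<Rightarrow> 'b) \<Rightarrow> bool" where
  "factor_map X T Y S p \<longleftrightarrow>
     continuous_on X p \<and> p ` X = Y \<and> (\<forall>x\<in>X. p (T x) = S (p x))"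

definition proximal_pair :: "('a::metric_space \<Rightarrow> 'a) \<Rightarrow> 'a \<Rightarrow> 'a \<Rightarrow> bool" where
  "proximal_pair T x y \<longleftrightarrow>
     liminf (\<lambda>k. ereal (dist ((T ^^ k) x) ((T ^^ k) y))) = 0"

definition proximal_map ::
  "'a::metric_space set \<Rightarrow> ('a \<Rightarrow> 'a) \<Rightarrow> ('a \<Rightarrow> 'b) \<Rightarrow> bool" where
  "proximal_map X T p \<longleftrightarrow> (\<forall>x\<in>X. \<forall>y\<in>X. p x = p y \<longrightarrow> proximal_pair T x y)"

definition thick :: "nat set \<Rightarrow> bool" where
  "thick F \<longleftrightarrow> (\<forall>L\<ge>1. \<exists>m\<ge>1. {m..m + L} \<subseteq> F)"

text \<open>
  \<^const>\<open>Min\<close> is meaningful only for a nonempty index set, i.e. for \<open>n \<ge> 2\<close>. The points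
  \<open>x\<^sub>1, \<dots>, x\<^sub>n\<close> are the values of \<open>x\<close> on \<open>{1..n}\<close>.
\<close>

definition tuplewise_thickly_sensitive ::
  "nat \<Rightarrow> 'a::metric_space set \<Rightarrow> ('a \<Rightarrow> 'a) \<Rightarrow> bool" where
  "tuplewise_thickly_sensitive n X T \<longleftrightarrow>
     (\<exists>\<delta>>0. \<forall>U. openin (top_of_set X) U \<and> U \<noteq> {} \<longrightarrow>
        (\<exists>x :: nat \<Rightarrow> 'a. (\<forall>i\<in>{1..n}. x i \<in> U) \<and>
           thick {k. k \<ge> 1 \<and>
             Min ((\<lambda>(i, j). dist ((T ^^ k) (x i)) ((T ^^ k) (x j))) `
                    {(i, j). 1 \<le> i \<and> i < j \<and> j \<le> n}) > \<delta>}))"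

end

theory Submission
  imports Defs
begin

text \<open>
  By proximality, two points that \<open>T\<close> keeps \<open>\<delta>\<close>-apart forever have different images in \<open>Y\<close>.
  Compactness of \<open>X \<times> X\<close> makes this quantitative: points that stay \<open>\<delta>\<close>-apart for \<open>M\<close> steps have
  images more than \<open>1 / (M + 1)\<close> apart. Lifting an open set of \<open>Y\<close> to \<open>X\<close>, the separation times of
  a tuple in the lift pass to the projected tuple, except that each block of consecutive times loses
  its last \<open>M\<close> elements; this does not affect thickness.
\<close>

text \<open>Membership of \<open>k\<close> in \<open>G\<close> needs a whole window of
  \<open>F\<close> after \<open>k\<close>. A block of \<open>F\<close> longer by the fixed amount
  \<open>M\<close> leaves room for this window at every \<open>k\<close> up to
  \<open>m + L\<close>.\<close>

lemma thick_shrink_blocks: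
  assumes "thick F" and "\<And>k. k \<ge> 1 \<Longrightarrow> {k..k + M} \<subseteq> F \<Longrightarrow> k \<in> G"
  shows "thick G"
  unfolding thick_def
proof (intro allI impI)
  fix L :: nat assume "L \<ge> 1"
  then obtain m where m: "m \<ge> 1" "{m..m + (L + M)} \<subseteq> F"
    using assms(1) unfolding thick_def by (metis trans_le_add1)
  have "k \<in> G" if "k \<in> {m..m + L}" for k
    using m that by (intro assms(2)) (auto simp: subset_iff)
  with m(1) show "\<exists>m\<ge>1. {m..m + L} \<subseteq> G" by blast
qed

lemma proximal_pair_imp_close:
  assumes "proximal_pair T x y" and "\<delta> > 0"
  shows "\<exists>l. dist ((T ^^ l) x) ((T ^^ l) y) < \<delta>"
proof (rule ccontr)
  assume "\<not> ?thesis"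
  then have "ereal \<delta> \<le> liminf (\<lambda>k. ereal (dist ((T ^^ k) x) ((T ^^ k) y)))"
    by (intro Liminf_bounded always_eventually) (auto simp: not_less)
  with assms show False unfolding proximal_pair_def by simp
qed

lemma funpow_in_invariant:
  assumes "T ` X \<subseteq> X" and "x \<in> X"
  shows "(T ^^ k) x \<in> X"
  using assms by (induction k) auto

lemma continuous_on_funpow:
  fixes T :: "'a::topological_space \<Rightarrow> 'a"
  assumes "continuous_on X T" and "T ` X \<subseteq> X"
  shows "continuous_on X (T ^^ k)"
proof (induction k)
  case (Suc k)
  have "(T ^^ k) ` X \<subseteq> X" using funpow_in_invariant[OF assms(2)] by blast
  then have "continuous_on X (T \<circ> T ^^ k)"
    by (intro continuous_on_compose Suc continuous_on_subset[OF assms(1)])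
  then show ?case by simp
qed (simp add: id_def)

lemma factor_map_funpow:
  assumes "T ` X \<subseteq> X" and "factor_map X T Y S p" and "x \<in> X"
  shows "p ((T ^^ k) x) = (S ^^ k) (p x)"
  using assms funpow_in_invariant[OF assms(1,3)]
  by (induction k) (auto simp: factor_map_def)

text \<open>Pairs violating the bound for each \<open>M\<close> would accumulate at a pair with
  equal images that stays \<delta>-apart at all times, against proximality. The weak inequality
  \<le> in the hypothesis and the strict one in the conclusion make both conditions on a violating
  pair closed, so they survive the limit.\<close>

lemma proximal_map_uniform_separation:
  fixes X :: "'a::metric_space set" and p :: "'a \<Rightarrow> 'b::metric_space"
  assumes "compact X" and contT: "continuous_on X T" and inv: "T ` X \<subseteq> X"
    and contp: "continuous_on X p" and prox: "proximal_map X T p" and "\<delta> > 0"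
  obtains M :: nat where
    "\<And>x y. x \<in> X \<Longrightarrow> y \<in> X \<Longrightarrow> \<forall>l\<le>M. \<delta> \<le> dist ((T ^^ l) x) ((T ^^ l) y) \<Longrightarrow>
       1 / (real M + 1) < dist (p x) (p y)"
proof (rule ccontr)
  assume no_bound: "\<not> thesis"
  have "\<exists>z\<in>X \<times> X. (\<forall>l\<le>M. \<delta> \<le> dist ((T ^^ l) (fst z)) ((T ^^ l) (snd z))) \<and>
      dist (p (fst z)) (p (snd z)) \<le> 1 / (real M + 1)" for M
  proof (rule ccontr)
    assume no_pair: "\<not> ?thesis"
    have thesis
    proof (rule that[of M], rule ccontr)
      fix x y
      assume "x \<in> X" "y \<in> X" "\<forall>l\<le>M. \<delta> \<le> dist ((T ^^ l) x) ((T ^^ l) y)"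
        "\<not> 1 / (real M + 1) < dist (p x) (p y)"
      with no_pair show False by (auto simp: not_less)
    qed
    with no_bound show False by simp
  qed
  then obtain z where zX: "\<And>M. z M \<in> X \<times> X"
    and apart: "\<And>M l. l \<le> M \<Longrightarrow> \<delta> \<le> dist ((T ^^ l) (fst (z M))) ((T ^^ l) (snd (z M)))"
    and close: "\<And>M. dist (p (fst (z M))) (p (snd (z M))) \<le> 1 / (real M + 1)"
    by metis
  have "seq_compact (X \<times> X)"
    using \<open>compact X\<close> by (simp add: compact_Times compact_imp_seq_compact)
  then obtain w r where w: "w \<in> X \<times> X" and r: "strict_mono r" and lim: "(z \<circ> r) \<longlonglongrightarrow> w"
    using seq_compactE[of "X \<times> X" z] zX by metis
  \<comment> \<open>The target type is left arbitrary because \<open>f\<close> will be both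
    \<open>p\<close> and an iterate of \<open>T\<close>.\<close>
  have lim_dist: "(\<lambda>i. dist (f (fst (z (r i)))) (f (snd (z (r i))))) \<longlonglongrightarrow>
      dist (f (fst w)) (f (snd w))"
    if "continuous_on X f" for f :: "'a \<Rightarrow> 'c::metric_space"
  proof -
    have "continuous_on (X \<times> X) (\<lambda>v. dist (f (fst v)) (f (snd v)))"
      by (intro continuous_intros continuous_on_compose2[OF that]) auto
    from continuous_on_tendsto_compose[OF this lim w] show ?thesis
      using zX by (simp add: o_def)
  qed
  have "(\<lambda>i. 1 / (real (r i) + 1)) \<longlonglongrightarrow> 0"
    using LIMSEQ_subseq_LIMSEQ[OF LIMSEQ_inverse_real_of_nat r]
    by (simp add: o_def inverse_eq_divide add.commute)
  \<comment> \<open>The limit pair lies in one fibre of \<open>p\<close>, so proximality applies to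
    it.\<close>
  then have "dist (p (fst w)) (p (snd w)) \<le> 0"
    using close by (intro LIMSEQ_le[OF lim_dist[OF contp]]) auto
  with w prox have "proximal_pair T (fst w) (snd w)"
    by (auto simp: proximal_map_def)
  then obtain l where l: "dist ((T ^^ l) (fst w)) ((T ^^ l) (snd w)) < \<delta>"
    using proximal_pair_imp_close \<open>\<delta> > 0\<close> by blast
  \<comment> \<open>With \<open>l\<close> fixed, the growing windows of times up to
    \<open>r i\<close> contain \<open>l\<close> as soon as \<open>i\<close> reaches
    \<open>l\<close>, since \<open>r i\<close> is at least \<open>i\<close>.\<close>
  have "\<delta> \<le> dist ((T ^^ l) (fst w)) ((T ^^ l) (snd w))"
  proof (rule LIMSEQ_le_const[OF lim_dist[OF continuous_on_funpow[OF contT inv]]], intro exI allI impI)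
    fix i assume "l \<le> i"
    then have "l \<le> r i" using seq_suble[OF r, of i] by linarith
    then show "\<delta> \<le> dist ((T ^^ l) (fst (z (r i)))) ((T ^^ l) (snd (z (r i))))" by (rule apart)
  qed
  with l show False by simp
qed

text \<open>With \<open>n\<close> at least 2 the pair \<open>(1, 2)\<close> is an index, so
  \<open>Min\<close> ranges over a nonempty finite set and can be traded for pairwise
  inequalities.\<close>

lemma less_Min_pairs_iff:
  fixes f :: "nat \<Rightarrow> nat \<Rightarrow> 'a::linorder"
  assumes "n \<ge> 2"
  shows "c < Min ((\<lambda>(i, j). f i j) ` {(i, j). 1 \<le> i \<and> i < j \<and> j \<le> n}) \<longleftrightarrow>
    (\<forall>i j. 1 \<le> i \<longrightarrow> i < j \<longrightarrow> j \<le> n \<longrightarrow> c < f i j)"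
proof -
  have "finite {(i, j). 1 \<le> i \<and> i < j \<and> j \<le> n}"
    by (rule finite_subset[of _ "{..n} \<times> {..n}"]) auto
  moreover have "(1, 2) \<in> {(i, j). 1 \<le> i \<and> i < j \<and> j \<le> n}" using assms by simp
  then have "{(i, j). 1 \<le> i \<and> i < j \<and> j \<le> n} \<noteq> {}" by blast
  ultimately show ?thesis by (auto simp: Min_gr_iff)
qed

theorem proposition4p8:
  fixes X :: "'a::metric_space set" and T :: "'a \<Rightarrow> 'a"
    and Y :: "'b::metric_space set" and S :: "'b \<Rightarrow> 'b"
    and \<pi> :: "'a \<Rightarrow> 'b" and n :: nat
  assumes "dynamical_system X T"
    and "dynamical_system Y S"
    and "factor_map X T Y S \<pi>"
    and "n \<ge> 2"
    and "tuplewise_thickly_sensitive n X T"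
    and "proximal_map X T \<pi>"
  shows "tuplewise_thickly_sensitive n Y S"
proof -
  have X: "compact X" "continuous_on X T" "T ` X \<subseteq> X"
    using assms(1) by (auto simp: dynamical_system_def)
  have \<pi>: "continuous_on X \<pi>" "\<pi> ` X = Y"
    using assms(3) by (auto simp: factor_map_def)
  obtain \<delta> where "\<delta> > 0" and sens: "\<And>U. openin (top_of_set X) U \<Longrightarrow> U \<noteq> {} \<Longrightarrow>
      \<exists>x. (\<forall>i\<in>{1..n}. x i \<in> U) \<and> thick {k. k \<ge> 1 \<and>
        (\<forall>i j. 1 \<le> i \<longrightarrow> i < j \<longrightarrow> j \<le> n \<longrightarrow> \<delta> < dist ((T ^^ k) (x i)) ((T ^^ k) (x j)))}"
    using assms(5) unfolding tuplewise_thickly_sensitive_def less_Min_pairs_iff[OF assms(4)] by blast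
  obtain M where M: "\<And>x y. x \<in> X \<Longrightarrow> y \<in> X \<Longrightarrow>
      \<forall>l\<le>M. \<delta> \<le> dist ((T ^^ l) x) ((T ^^ l) y) \<Longrightarrow> 1 / (real M + 1) < dist (\<pi> x) (\<pi> y)"
    using proximal_map_uniform_separation[OF X \<pi>(1) assms(6) \<open>\<delta> > 0\<close>] by blast
  show ?thesis
    unfolding tuplewise_thickly_sensitive_def less_Min_pairs_iff[OF assms(4)]
  \<comment> \<open>The sensitivity constant comes from \<delta> and \<open>M\<close>, both fixed
    before \<open>V\<close> is given.\<close>
  proof (intro exI[of _ "1 / (real M + 1)"] conjI allI impI; (elim conjE)?)
    fix V assume V: "openin (top_of_set Y) V" "V \<noteq> {}"
    let ?U = "X \<inter> \<pi> -` V"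
    have "openin (top_of_set X) ?U"
      using \<pi> V(1) continuous_on_open by blast
    moreover have "?U \<noteq> {}"
      using V \<pi>(2) openin_imp_subset by fastforce
    ultimately obtain x where x: "\<forall>i\<in>{1..n}. x i \<in> ?U"
      and F: "thick {k. k \<ge> 1 \<and> (\<forall>i j. 1 \<le> i \<longrightarrow> i < j \<longrightarrow> j \<le> n \<longrightarrow>
        \<delta> < dist ((T ^^ k) (x i)) ((T ^^ k) (x j)))}" (is "thick ?F")
      using sens by blast
    have "thick {k. k \<ge> 1 \<and> (\<forall>i j. 1 \<le> i \<longrightarrow> i < j \<longrightarrow> j \<le> n \<longrightarrow>
        1 / (real M + 1) < dist ((S ^^ k) (\<pi> (x i))) ((S ^^ k) (\<pi> (x j))))}"
    proof (rule thick_shrink_blocks[OF F], intro CollectI conjI allI impI)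
      fix k i j assume block: "{k..k + M} \<subseteq> ?F" and ij: "1 \<le> i" "i < j" "j \<le> n"
      have xX: "x i \<in> X" "x j \<in> X" using x ij by auto
      \<comment> \<open>The bound \<open>M\<close> is applied to the points moved to time
        \<open>k\<close>, so the times \<open>k\<close> to \<open>k + M\<close> of the block become
        the times 0 to \<open>M\<close>.\<close>
      have "\<delta> \<le> dist ((T ^^ l) ((T ^^ k) (x i))) ((T ^^ l) ((T ^^ k) (x j)))" if "l \<le> M" for l
      proof -
        have "k + l \<in> ?F" by (rule subsetD[OF block]) (use that in simp)
        then have "\<delta> < dist ((T ^^ (l + k)) (x i)) ((T ^^ (l + k)) (x j))"
          using ij by (simp add: add.commute)
        then show ?thesis by (simp add: funpow_add)
      qed
      then have "1 / (real M + 1) < dist (\<pi> ((T ^^ k) (x i))) (\<pi> ((T ^^ k) (x j)))"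
        using xX by (intro M funpow_in_invariant[OF X(3)]) auto
      then show "1 / (real M + 1) < dist ((S ^^ k) (\<pi> (x i))) ((S ^^ k) (\<pi> (x j)))"
        using xX by (simp add: factor_map_funpow[OF X(3) assms(3)])
    qed
    with x show "\<exists>y. (\<forall>i\<in>{1..n}. y i \<in> V) \<and> thick {k. k \<ge> 1 \<and>
        (\<forall>i j. 1 \<le> i \<longrightarrow> i < j \<longrightarrow> j \<le> n \<longrightarrow> 1 / (real M + 1) < dist ((S ^^ k) (y i)) ((S ^^ k) (y j)))}"
      by (intro exI[of _ "\<lambda>i. \<pi> (x i)"]) auto
  qed simp
qed

end
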